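(* For all $k\geq 3$ and $r\geq 1$, $$\lim_{n\to\infty}P\big(\mathcal{I}_k(n)=r\big)=\frac{h_{0,k}(r)}{k^r}-\frac{h_{0,k}(r+1)}{k^{r+1}}=\frac{2}{(k+1)k^{r+1}}\sum_{j=1}^k\big(1+(-1)^{j+1}\big)\cot^2\frac{j\pi}{2(k+1)}\Big(1+2\cos\frac{j\pi}{k+1}\Big)^{r-1}\Big(k-1-2\cos\frac{j\pi}{k+1}\Big).$$
   Context: $[k]=\{1,\dots,k\}$ with its usual linear order. A word $\pi_1\cdots\pi_n\in[k]^n$ is a staircase if $|\pi_{i+1}-\pi_i|\leq 1$ for all $i=1,\dots,n-1$. $h_{0,k}(r)$ denotes the number of staircase words in $[k]^r$. For $\pi\in[k]^n$, $\mathcal{I}_k(\pi)$ is the largest $r\leq n$ such that the prefix $\pi_1\cdots\pi_r$ is a staircase word. $\mathcal{I}_k(n)$ denotes $\mathcal{I}_k(\pi)$ for $\pi$ chosen uniformly at random from $[k]^n$.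
   Formalization: The prefactor 2/((k+1)k^{r+1}) of the trigonometric sum is corrected to 1/((k+1)k^{r+1}); the printed formula gives twice the true value (for k=3, r=1 it yields 4/9 instead of 1-7/9=2/9). *)

theory Defs
  imports "HOL-Probability.Probability"
begin

text \<open>Words over \<open>[k] = {1, \<dots>, k}\<close> are lists of natural numbers; list positions are counted from 0.\<close>

definition words :: "nat \<Rightarrow> nat \<Rightarrow> nat list set" where
  "words k n = {w. length w = n \<and> set w \<subseteq> {1..k}}"

definition staircase :: "nat list \<Rightarrow> bool" where
  "staircase w \<longleftrightarrow> (\<forall>i. Suc i < length w \<longrightarrow> \<bar>int (w ! Suc i) - int (w ! i)\<bar> \<le> 1)"

definition h0 :: "nat \<Rightarrow> nat \<Rightarrow> nat" where
  "h0 k r = card {w \<in> words k r. staircase w}"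

text \<open>The empty prefix is a staircase word, so the maximum is over a nonempty set.\<close>

definition staircase_prefix :: "nat list \<Rightarrow> nat" where
  "staircase_prefix w = Max {r. r \<le> length w \<and> staircase (take r w)}"

definition prob_prefix :: "nat \<Rightarrow> nat \<Rightarrow> nat \<Rightarrow> real" where
  "prob_prefix k n r = measure_pmf.prob (pmf_of_set (words k n)) {w. staircase_prefix w = r}"

text \<open>
  On the constant in the trigonometric formula for the limit: the source prints
  \<open>2 / ((k + 1) k^(r + 1))\<close> in front of the sum. The factor \<open>1 + (-1)^(j + 1)\<close> already
  contributes a 2 for odd \<open>j\<close>, and the printed value is twice \<open>h0 k r / k^r - h0 k (r + 1) / k^(r + 1)\<close>
  (for \<open>k = 3\<close>, \<open>r = 1\<close> it is 4/9, whereas \<open>1 - 7/9 = 2/9\<close>). The correct constant is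
  \<open>1 / ((k + 1) k^(r + 1))\<close>.
\<close>

end

theory Submission
  imports Defs
begin

text \<open>
  Once \<open>n > r\<close>, the event \<open>staircase_prefix w = r\<close> only concerns the first \<open>r + 1\<close> letters: the prefix
  of length \<open>r\<close> is a staircase and the prefix of length \<open>r + 1\<close> is not, so the probability is constant
  in \<open>n\<close>. The number of staircase words with prescribed first letter \<open>i\<close> satisfies the recurrence
  \<open>a(r + 1, i) = a(r, i - 1) + a(r, i) + a(r, i + 1)\<close> with zero boundary values at \<open>0\<close> and \<open>k + 1\<close>.
  This operator has the eigenvectors \<open>sin (i \<theta>)\<close>, \<open>\<theta> = j \<pi> / (k + 1)\<close>, with eigenvalues
  \<open>1 + 2 cos \<theta>\<close>, and the formula comes from expanding the constant vector in this basis.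
\<close>

section \<open>Words and staircase prefixes\<close>

lemma finite_words: "finite (words k n)"
  unfolding words_def using finite_lists_length_eq[of "{1..k}" n] by (simp add: conj_commute)

lemma card_words: "card (words k n) = k ^ n"
  unfolding words_def using card_lists_length_eq[of "{1..k}" n] by (simp add: conj_commute)

lemma staircase_take: "staircase w \<Longrightarrow> staircase (take m w)"
  unfolding staircase_def by simp

lemma staircase_Cons_Cons:
  "staircase (x # y # w) \<longleftrightarrow> \<bar>int y - int x\<bar> \<le> 1 \<and> staircase (y # w)"
  unfolding staircase_def by (auto simp: nth_Cons' less_Suc_eq_0_disj)

text \<open>Prefixes of staircases are staircases, so the admissible lengths form an initial
  segment, and its maximum is \<open>r\<close> as soon as \<open>r\<close> belongs to it and
  \<open>r + 1\<close> does not. The strict bound on \<open>r\<close> makes the prefix of length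
  \<open>r + 1\<close> genuinely longer.\<close>

lemma staircase_prefix_eq_iff:
  assumes "r < length w"
  shows "staircase_prefix w = r \<longleftrightarrow> staircase (take r w) \<and> \<not> staircase (take (r + 1) w)"
proof -
  let ?S = "{m. m \<le> length w \<and> staircase (take m w)}"
  have fin: "finite ?S" by (rule finite_subset[of _ "{..length w}"]) auto
  have "0 \<in> ?S" by (simp add: staircase_def)
  hence ne: "?S \<noteq> {}" by blast
  have down: "staircase (take m w)" if "staircase (take m' w)" "m \<le> m'" for m m'
    using staircase_take[OF that(1), of m] that(2) by (simp add: min_def)
  have "Max ?S = r \<longleftrightarrow> r \<in> ?S \<and> (\<forall>m\<in>?S. m \<le> r)"
    using fin ne by (rule Max_eq_iff)
  also have "\<dots> \<longleftrightarrow> staircase (take r w) \<and> \<not> staircase (take (r + 1) w)"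
  proof (intro iffI conjI ballI; (elim conjE)?)
    assume max: "\<forall>m\<in>?S. m \<le> r"
    show "\<not> staircase (take (r + 1) w)"
    proof
      assume "staircase (take (r + 1) w)"
      hence "r + 1 \<in> ?S" using assms by simp
      thus False using max by fastforce
    qed
  next
    fix m assume "\<not> staircase (take (r + 1) w)" "m \<in> ?S"
    thus "m \<le> r" using down[of m "r + 1"] by force
  qed (use assms in auto)
  finally show ?thesis unfolding staircase_prefix_def .
qed

text \<open>Cutting a word after \<open>r\<close> letters leaves a staircase and an unconstrained
  tail, chosen independently.\<close>

lemma card_words_take:
  assumes "r \<le> n"
  shows "card {w \<in> words k n. staircase (take r w)} = h0 k r * k ^ (n - r)"
proof -
  have "bij_betw (\<lambda>w. (take r w, drop r w)) {w \<in> words k n. staircase (take r w)}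
          ({w \<in> words k r. staircase w} \<times> words k (n - r))"
    by (rule bij_betwI[where g = "\<lambda>(u, v). u @ v"])
       (use assms in \<open>auto simp: words_def subset_iff dest: in_set_takeD in_set_dropD\<close>)
  thus ?thesis
    by (simp add: bij_betw_same_card card_cartesian_product card_words h0_def)
qed

lemma prob_prefix_eq:
  assumes "k \<ge> 1" and "r < n"
  shows "prob_prefix k n r = real (h0 k r) / real k ^ r - real (h0 k (r + 1)) / real k ^ (r + 1)"
proof -
  let ?A = "\<lambda>r. {w \<in> words k n. staircase (take r w)}"
  have ne: "words k n \<noteq> {}"
    using card_words[of k n] assms(1) by auto
  \<comment> \<open>The event is a difference of two nested prefix events, so its size is a
    difference of two counts.\<close>
  have eq: "words k n \<inter> {w. staircase_prefix w = r} = ?A r - ?A (r + 1)"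
    using assms(2) staircase_prefix_eq_iff by (auto simp: words_def)
  have sub: "?A (r + 1) \<subseteq> ?A r"
  proof
    fix w assume "w \<in> ?A (r + 1)"
    thus "w \<in> ?A r" using staircase_take[of "take (r + 1) w" r] by simp
  qed
  have fin: "finite (?A m)" for m using finite_words by simp
  have "real (card (?A r - ?A (r + 1))) = real (card (?A r)) - real (card (?A (r + 1)))"
    using card_mono[OF fin sub] by (subst card_Diff_subset[OF fin sub]) (simp add: of_nat_diff)
  also have "\<dots> = real (h0 k r) * real k ^ (n - r) - real (h0 k (r + 1)) * real k ^ (n - (r + 1))"
    using assms by (subst (1 2) card_words_take) auto
  finally have "prob_prefix k n r =
      (real (h0 k r) * real k ^ (n - r) - real (h0 k (r + 1)) * real k ^ (n - (r + 1))) / real k ^ n"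
    unfolding prob_prefix_def
    using measure_pmf_of_set[OF ne finite_words, of "{w. staircase_prefix w = r}"]
    by (simp add: eq card_words)
  also have "\<dots> = real (h0 k r) / real k ^ r - real (h0 k (r + 1)) / real k ^ (r + 1)"
  proof -
    have "real k ^ (n - m) / real k ^ n = 1 / real k ^ m" if "m \<le> n" for m
      using that assms by (simp add: power_diff)
    from this[of r] this[of "r + 1"] assms(2) show ?thesis
      by (simp add: diff_divide_distrib times_divide_eq_right[symmetric]
            del: power_Suc times_divide_eq_right) simp
  qed
  finally show ?thesis .
qed

section \<open>The transfer recurrence\<close>

text \<open>Here \<open>r\<close> counts steps, not letters: the words are nonempty, so
  \<open>hd\<close> is meaningful, and the eigenvalues later enter with exponent exactly
  \<open>r\<close>.\<close>

definition staircases_from :: "nat \<Rightarrow> nat \<Rightarrow> nat \<Rightarrow> nat list set" where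
  "staircases_from k r i = {w \<in> words k (Suc r). staircase w \<and> hd w = i}"

lemma finite_staircases_from: "finite (staircases_from k r i)"
  unfolding staircases_from_def using finite_words by simp

lemma staircases_from_empty: "i \<notin> {1..k} \<Longrightarrow> staircases_from k r i = {}"
  unfolding staircases_from_def words_def by (auto simp: length_Suc_conv)

lemma staircases_from_0: "i \<in> {1..k} \<Longrightarrow> staircases_from k 0 i = {[i]}"
  unfolding staircases_from_def words_def by (auto simp: length_Suc_conv staircase_def)

lemma h0_Suc_eq: "h0 k (Suc r) = (\<Sum>i = 1..k. card (staircases_from k r i))"
proof -
  have "{w \<in> words k (Suc r). staircase w} = (\<Union>i\<in>{1..k}. staircases_from k r i)"
    unfolding staircases_from_def words_def by (auto simp: length_Suc_conv)
  thus ?thesis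
    unfolding h0_def
    by (simp, subst card_UN_disjoint)
       (auto simp: finite_staircases_from, auto simp: staircases_from_def)
qed

text \<open>Classify by the second letter. Neighbours \<open>0\<close> and \<open>k + 1\<close> need
  no special case, since no word over the alphabet starts there.\<close>

lemma staircases_from_Suc:
  assumes "i \<in> {1..k}"
  shows "staircases_from k (Suc r) i = (#) i `
           (staircases_from k r (i - 1) \<union> staircases_from k r i \<union> staircases_from k r (i + 1))"
    (is "?L = _ ` ?R")
proof -
  have "i # w \<in> ?L \<longleftrightarrow> w \<in> ?R" for w
    using assms
    by (cases w) (auto simp: staircases_from_def words_def staircase_Cons_Cons)
  moreover have "\<exists>v. w = i # v" if "w \<in> ?L" for w
    using that by (cases w) (auto simp: staircases_from_def words_def)
  ultimately show ?thesis by blast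
qed

lemma card_staircases_from_Suc:
  assumes "i \<in> {1..k}"
  shows "card (staircases_from k (Suc r) i) = card (staircases_from k r (i - 1)) +
           card (staircases_from k r i) + card (staircases_from k r (i + 1))"
proof -
  have disj: "staircases_from k r i \<inter> staircases_from k r i' = {}" if "i \<noteq> i'" for i i'
    using that by (auto simp: staircases_from_def)
  have "card (staircases_from k (Suc r) i) = card (staircases_from k r (i - 1) \<union>
          staircases_from k r i \<union> staircases_from k r (i + 1))"
    by (subst staircases_from_Suc[OF assms]) (simp add: card_image)
  also have "\<dots> = card (staircases_from k r (i - 1)) + card (staircases_from k r i) +
                  card (staircases_from k r (i + 1))"
  proof -
    have "i - 1 \<noteq> i" "i - 1 \<noteq> i + 1" "i \<noteq> i + 1" using assms by auto
    hence "(staircases_from k r (i - 1) \<union> staircases_from k r i) \<inter> staircases_from k r (i + 1) = {}"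
        "staircases_from k r (i - 1) \<inter> staircases_from k r i = {}"
      using disj by blast+
    thus ?thesis
      by (metis card_Un_disjoint finite_UnI finite_staircases_from)
  qed
  finally show ?thesis .
qed

section \<open>Trigonometric sums\<close>

text \<open>The weight is 2 for odd \<open>j\<close> and 0 for even \<open>j\<close>, and 2 sin y
  cos(jy) = sin((j+1)y) - sin((j-1)y) telescopes over odd \<open>j\<close>.\<close>

lemma sin_times_sum_odd_cos:
  "sin y * (\<Sum>j = 1..n. (1 + (-1) ^ (j + 1)) * cos (real j * y)) =
     sin (real (if odd n then n + 1 else n) * y)"
proof (induction n)
  case (Suc n)
  show ?case
  proof (cases "odd n")
    case False
    have "sin y * (2 * cos (real (Suc n) * y)) = sin (real (Suc n) * y + y) - sin (real (Suc n) * y - y)"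
      by (simp add: sin_add sin_diff)
    hence "sin y * (2 * cos (real (Suc n) * y)) = sin (real (n + 2) * y) - sin (real n * y)"
      by (simp add: algebra_simps)
    with False Suc show ?thesis by (simp add: algebra_simps)
  qed (use Suc in \<open>simp add: algebra_simps\<close>)
qed simp

lemma sum_odd_weights: "(\<Sum>j = 1..n. 1 + (-1) ^ (j + 1)) = (real n + of_bool (odd n) :: real)"
  by (induction n) auto

lemma sum_odd_cos:
  assumes "m \<le> k"
  shows "(\<Sum>j = 1..k. (1 + (-1) ^ (j + 1)) * cos (real m * (real j * pi / (real k + 1)))) =
           (if m = 0 then real k + 1 else 0) - of_bool (even k) * (-1) ^ m"
proof (cases "m = 0")
  case True
  thus ?thesis using sum_odd_weights[of k] by auto
next
  case False
  define y where "y = real m * pi / (real k + 1)"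
  have "real m * pi < pi * (real k + 1)" using assms by simp
  hence "0 < y" "y < pi"
    using False by (simp_all add: y_def divide_less_eq)
  hence "sin y > 0" by (rule sin_gt_zero)
  have ky: "real (k + 1) * y = real m * pi" by (simp add: y_def field_simps)
  \<comment> \<open>Since (k+1)y = m pi, the sine vanishes for odd \<open>k\<close>; for even
    \<open>k\<close> it is sin(m pi - y).\<close>
  have "sin (real (if odd k then k + 1 else k) * y) = sin y * (- of_bool (even k) * (-1) ^ m)"
  proof (cases "odd k")
    case True
    thus ?thesis using ky by (simp add: algebra_simps)
  next
    case even: False
    have "real k * y = real m * pi - y" using ky by (simp add: algebra_simps)
    thus ?thesis using even by (simp add: sin_diff mult.commute)
  qed
  hence "sin y * (\<Sum>j = 1..k. (1 + (-1) ^ (j + 1)) * cos (real j * y)) =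
      sin y * (- of_bool (even k) * (-1) ^ m)"
    by (simp only: sin_times_sum_odd_cos)
  hence "(\<Sum>j = 1..k. (1 + (-1) ^ (j + 1)) * cos (real j * y)) = - of_bool (even k) * (-1) ^ m"
    using \<open>sin y > 0\<close> by (subst (asm) mult_left_cancel) auto
  thus ?thesis using False by (simp add: y_def mult.left_commute)
qed

text \<open>Around the midpoint u = (i + 1/2)x the difference of sines is 2 cos u sin(x/2) and the
  sum of cosines is 2 cos u cos(x/2).\<close>

lemma cot_half_sin_diff:
  assumes "sin (x / 2) \<noteq> (0 :: real)"
  shows "cot (x / 2) * (sin (real (Suc i) * x) - sin (real i * x)) = cos (real (Suc i) * x) + cos (real i * x)"
proof -
  define u where "u = (real i + 1 / 2) * x"
  have *: "real (Suc i) * x = u + x / 2" "real i * x = u - x / 2"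
    by (simp_all add: u_def field_simps)
  show ?thesis
    unfolding * using assms by (simp add: sin_add sin_diff cos_add cos_diff cot_def)
qed

lemma sin_half_angle_pos:
  assumes "j \<in> {1..k}"
  shows "sin (real j * pi / (real k + 1) / 2) > 0"
proof -
  have "real j < real k + 1" using assms by simp
  hence "real j * pi < pi * (real k + 1)" by simp
  hence "real j * pi / (real k + 1) < pi" by (simp add: divide_less_eq)
  moreover have "real j * pi / (real k + 1) > 0" using assms by simp
  moreover have "sin (x / 2) > 0" if "x < pi" "0 < x" for x :: real
    using that by (intro sin_gt_zero) auto
  ultimately show ?thesis by blast
qed

text \<open>
  Discrete differentiation in \<open>i\<close> turns the cotangent--sine sum into two cosine sums, whose
  parity-dependent contributions cancel.
\<close>

lemma sum_cot_half_sin: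
  assumes "i \<in> {1..k}"
  shows "(\<Sum>j = 1..k. (1 + (-1) ^ (j + 1)) * cot (real j * pi / (real k + 1) / 2) *
            sin (real i * (real j * pi / (real k + 1)))) = real k + 1"
proof -
  define \<theta> where "\<theta> j = real j * pi / (real k + 1)" for j
  define f where "f i = (\<Sum>j = 1..k. (1 + (-1) ^ (j + 1)) * cot (\<theta> j / 2) * sin (real i * \<theta> j))" for i
  have step: "f (Suc i) - f i = (if i = 0 then real k + 1 else 0)" if "i < k" for i
  proof -
    have "f (Suc i) - f i =
        (\<Sum>j = 1..k. (1 + (-1) ^ (j + 1)) * (cot (\<theta> j / 2) * (sin (real (Suc i) * \<theta> j) - sin (real i * \<theta> j))))"
      unfolding f_def by (simp only: sum_subtractf right_diff_distrib mult.assoc)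
    also have "\<dots> = (\<Sum>j = 1..k. (1 + (-1) ^ (j + 1)) * (cos (real (Suc i) * \<theta> j) + cos (real i * \<theta> j)))"
    proof (intro sum.cong refl arg_cong2[where f = "(*)"] cot_half_sin_diff)
      fix j assume "j \<in> {1..k}"
      thus "sin (\<theta> j / 2) \<noteq> 0" using sin_half_angle_pos[of j k] by (simp add: \<theta>_def)
    qed
    also have "\<dots> = (if i = 0 then real k + 1 else 0)"
      using that sum_odd_cos[of "Suc i" k] sum_odd_cos[of i k]
      unfolding \<theta>_def distrib_left sum.distrib by simp
    finally show ?thesis .
  qed
  \<comment> \<open>Starting from \<open>f 0 = 0\<close>, the only nonzero increment is the first,
    so \<open>f\<close> is constant from 1 to \<open>k\<close>.\<close>
  have "f i = real k + 1" if "1 \<le> i" "i \<le> k" for i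
    using that
  proof (induction i rule: dec_induct)
    case base
    have "f 0 = 0" by (simp add: f_def)
    with base step[of 0] show ?case by simp
  next
    case (step i)
    with \<open>\<And>i. i < k \<Longrightarrow> f (Suc i) - f i = _\<close>[of i] show ?case by simp
  qed
  thus ?thesis using assms by (simp add: f_def \<theta>_def)
qed

text \<open>Each product 2 sin(x/2) sin(ix) is a difference of cosines at consecutive half-integer
  multiples of \<open>x\<close>, so the sum telescopes.\<close>

lemma sin_half_times_sum_sin:
  "2 * sin (x / 2) * (\<Sum>i = 1..n. sin (real i * x)) = cos (x / 2) - cos (real n * x + x / 2)"
proof (induction n)
  case (Suc n)
  have *: "real n * x + x / 2 = real (Suc n) * x - x / 2" by (simp add: algebra_simps)
  have "2 * sin (x / 2) * sin (real (Suc n) * x) =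
      cos (real n * x + x / 2) - cos (real (Suc n) * x + x / 2)"
    unfolding * cos_add cos_diff by algebra
  with Suc show ?case by (simp add: distrib_left)
qed simp

text \<open>This is the total of the entries of an eigenvector. For odd \<open>j\<close> the far end
  of the telescoped sum is cos(j pi - x/2) = -cos(x/2), doubling the near end.\<close>

lemma sum_sin_odd:
  assumes "j \<in> {1..k}" "odd j"
  shows "(\<Sum>i = 1..k. sin (real i * (real j * pi / (real k + 1)))) = cot (real j * pi / (real k + 1) / 2)"
proof -
  define x where "x = real j * pi / (real k + 1)"
  have sin: "sin (x / 2) > 0" using sin_half_angle_pos[OF assms(1)] by (simp add: x_def)
  have "(real k + 1) * x = real j * pi" by (simp add: x_def)
  hence "real k * x + x / 2 = real j * pi - x / 2" by (simp add: distrib_right)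
  moreover have "cos (real j * pi - x / 2) = - cos (x / 2)"
    using assms(2) by (simp add: cos_diff mult.commute)
  ultimately have "2 * sin (x / 2) * (\<Sum>i = 1..k. sin (real i * x)) = 2 * cos (x / 2)"
    by (simp only: sin_half_times_sum_sin)
  thus ?thesis
    unfolding x_def[symmetric] cot_def using sin by (simp add: field_simps)
qed

section \<open>Spectral expansion\<close>

lemma sin_angle_boundary:
  assumes "i \<notin> {1..k}" "i \<le> k + 1"
  shows "sin (real i * (real j * pi / (real k + 1))) = 0"
proof -
  have "i = 0 \<or> i = k + 1" using assms by auto
  thus ?thesis
  proof
    assume "i = k + 1"
    hence "real i * (real j * pi / (real k + 1)) = real j * pi" by (simp add: field_simps)
    thus ?thesis by (simp only: sin_npi)
  qed simp
qed

text \<open>Both sides satisfy the same recurrence in \<open>r\<close>. The boundary indices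
  \<open>0\<close> and \<open>k + 1\<close> are included so that the induction hypothesis covers
  both neighbours of every letter.\<close>

lemma card_staircases_from_eq:
  assumes "i \<le> k + 1"
  shows "real (card (staircases_from k r i)) = 1 / (real k + 1) *
           (\<Sum>j = 1..k. (1 + (-1) ^ (j + 1)) * cot (real j * pi / (real k + 1) / 2) *
              sin (real i * (real j * pi / (real k + 1))) * (1 + 2 * cos (real j * pi / (real k + 1))) ^ r)"
  using assms
proof (induction r arbitrary: i)
  case (0 i)
  show ?case
  proof (cases "i \<in> {1..k}")
    case True
    \<comment> \<open>The initial vector is constant 1, and \<open>sum_cot_half_sin\<close> is its
      expansion in the eigenvectors.\<close>
    thus ?thesis using sum_cot_half_sin[OF True] by (simp add: staircases_from_0)
  next
    case False
    thus ?thesis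
      by (simp only: staircases_from_empty[OF False] sin_angle_boundary[OF False 0]) simp
  qed
next
  case (Suc r i)
  define \<theta> where "\<theta> j = real j * pi / (real k + 1)" for j
  define c where "c j = (1 + (-1) ^ (j + 1)) * cot (\<theta> j / 2)" for j
  show ?case
  proof (cases "i \<in> {1..k}")
    case True
    have IH: "real (card (staircases_from k r i')) =
        1 / (real k + 1) * (\<Sum>j = 1..k. c j * sin (real i' * \<theta> j) * (1 + 2 * cos (\<theta> j)) ^ r)"
      if "i' \<le> k + 1" for i'
      using Suc.IH[OF that] by (simp add: c_def \<theta>_def)
    have "real (card (staircases_from k (Suc r) i)) =
        1 / (real k + 1) * (\<Sum>j = 1..k. c j * sin (real (i - 1) * \<theta> j) * (1 + 2 * cos (\<theta> j)) ^ r
          + c j * sin (real i * \<theta> j) * (1 + 2 * cos (\<theta> j)) ^ r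
          + c j * sin (real (i + 1) * \<theta> j) * (1 + 2 * cos (\<theta> j)) ^ r)"
    proof -
      have "i - 1 \<le> k + 1" "i \<le> k + 1" "i + 1 \<le> k + 1" using True by auto
      thus ?thesis
        by (simp only: card_staircases_from_Suc[OF True] of_nat_add[of _ "card _"] IH sum.distrib distrib_left)
    qed
    also have "\<dots> = 1 / (real k + 1) * (\<Sum>j = 1..k. c j * sin (real i * \<theta> j) * (1 + 2 * cos (\<theta> j)) ^ Suc r)"
    \<comment> \<open>Eigenvector identity: sin(x - t) + sin x + sin(x + t) = (1 + 2 cos t) sin
      x.\<close>
    proof (intro arg_cong2[where f = "(*)"] refl sum.cong)
      fix j
      have *: "real (i - 1) * \<theta> j = real i * \<theta> j - \<theta> j" "real (i + 1) * \<theta> j = real i * \<theta> j + \<theta> j"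
        using True by (auto simp: of_nat_diff algebra_simps)
      show "c j * sin (real (i - 1) * \<theta> j) * (1 + 2 * cos (\<theta> j)) ^ r
          + c j * sin (real i * \<theta> j) * (1 + 2 * cos (\<theta> j)) ^ r
          + c j * sin (real (i + 1) * \<theta> j) * (1 + 2 * cos (\<theta> j)) ^ r
          = c j * sin (real i * \<theta> j) * (1 + 2 * cos (\<theta> j)) ^ Suc r"
        unfolding * sin_add sin_diff power_Suc by algebra
    qed
    finally show ?thesis by (simp add: c_def \<theta>_def)
  next
    case False
    thus ?thesis
      by (simp only: staircases_from_empty[OF False] sin_angle_boundary[OF False Suc.prems]) simp
  qed
qed

text \<open>One cotangent is the expansion coefficient of the constant vector; the second arises
  from summing the eigenvector over all first letters.\<close>

lemma h0_Suc_spectral: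
  "real (h0 k (Suc r)) = 1 / (real k + 1) *
     (\<Sum>j = 1..k. (1 + (-1) ^ (j + 1)) * (cot (real j * pi / (2 * (real k + 1))))\<^sup>2 *
        (1 + 2 * cos (real j * pi / (real k + 1))) ^ r)"
proof -
  define \<theta> where "\<theta> j = real j * pi / (real k + 1)" for j
  define w :: "nat \<Rightarrow> real" where "w j = 1 + (-1) ^ (j + 1)" for j
  have half: "real j * pi / (2 * (real k + 1)) = \<theta> j / 2" for j
    by (simp add: \<theta>_def field_simps)
  have "real (h0 k (Suc r)) = (\<Sum>i = 1..k. real (card (staircases_from k r i)))"
    by (simp add: h0_Suc_eq)
  also have "\<dots> = (\<Sum>i = 1..k. 1 / (real k + 1) *
      (\<Sum>j = 1..k. w j * cot (\<theta> j / 2) * sin (real i * \<theta> j) * (1 + 2 * cos (\<theta> j)) ^ r))"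
    unfolding \<theta>_def w_def by (intro sum.cong refl card_staircases_from_eq) auto
  also have "\<dots> = 1 / (real k + 1) *
      (\<Sum>j = 1..k. \<Sum>i = 1..k. w j * cot (\<theta> j / 2) * sin (real i * \<theta> j) * (1 + 2 * cos (\<theta> j)) ^ r)"
    unfolding sum_distrib_left[symmetric] by (subst sum.swap) (rule refl)
  also have "\<dots> = 1 / (real k + 1) * (\<Sum>j = 1..k. w j * (cot (\<theta> j / 2))\<^sup>2 * (1 + 2 * cos (\<theta> j)) ^ r)"
  proof (intro arg_cong2[where f = "(*)"] refl sum.cong)
    fix j assume j: "j \<in> {1..k}"
    \<comment> \<open>For even \<open>j\<close> both sides vanish with the weight, so the sum of
      sines is needed only for odd \<open>j\<close>.\<close>
    have "w j * (\<Sum>i = 1..k. sin (real i * \<theta> j)) = w j * cot (\<theta> j / 2)"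
      using sum_sin_odd[OF j] by (cases "odd j") (auto simp: w_def \<theta>_def)
    hence "w j * (\<Sum>i = 1..k. sin (real i * \<theta> j)) * (cot (\<theta> j / 2) * (1 + 2 * cos (\<theta> j)) ^ r)
        = w j * cot (\<theta> j / 2) * (cot (\<theta> j / 2) * (1 + 2 * cos (\<theta> j)) ^ r)"
      by (rule arg_cong)
    hence "w j * cot (\<theta> j / 2) * (\<Sum>i = 1..k. sin (real i * \<theta> j)) * (1 + 2 * cos (\<theta> j)) ^ r
        = w j * (cot (\<theta> j / 2))\<^sup>2 * (1 + 2 * cos (\<theta> j)) ^ r"
      by (simp only: power2_eq_square mult_ac)
    thus "(\<Sum>i = 1..k. w j * cot (\<theta> j / 2) * sin (real i * \<theta> j) * (1 + 2 * cos (\<theta> j)) ^ r)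
        = w j * (cot (\<theta> j / 2))\<^sup>2 * (1 + 2 * cos (\<theta> j)) ^ r"
      by (simp only: sum_distrib_left sum_distrib_right)
  qed
  finally show ?thesis unfolding half by (simp add: w_def \<theta>_def)
qed

theorem theorem1p3:
  fixes k r :: nat
  assumes "k \<ge> 3" and "r \<ge> 1"
  shows "(\<lambda>n. prob_prefix k n r) \<longlonglongrightarrow>
           real (h0 k r) / real k ^ r - real (h0 k (r + 1)) / real k ^ (r + 1) \<and>
         real (h0 k r) / real k ^ r - real (h0 k (r + 1)) / real k ^ (r + 1) =
           1 / ((real k + 1) * real k ^ (r + 1)) *
           (\<Sum>j = 1..k. (1 + (-1) ^ (j + 1)) * (cot (real j * pi / (2 * (real k + 1))))\<^sup>2 *
              (1 + 2 * cos (real j * pi / (real k + 1))) ^ (r - 1) *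
              (real k - 1 - 2 * cos (real j * pi / (real k + 1))))"
proof
  have "\<forall>\<^sub>F n in sequentially. prob_prefix k n r =
      real (h0 k r) / real k ^ r - real (h0 k (r + 1)) / real k ^ (r + 1)"
    using eventually_gt_at_top[of r] by eventually_elim (use assms in \<open>simp add: prob_prefix_eq\<close>)
  thus "(\<lambda>n. prob_prefix k n r) \<longlonglongrightarrow>
      real (h0 k r) / real k ^ r - real (h0 k (r + 1)) / real k ^ (r + 1)"
    by (rule tendsto_eventually)
next
  define C where "C j = (1 + (-1) ^ (j + 1)) * (cot (real j * pi / (2 * (real k + 1))))\<^sup>2" for j
  define l where "l j = 1 + 2 * cos (real j * pi / (real k + 1))" for j
  \<comment> \<open>The spectral formula covers positive lengths only; \<open>s\<close> is the
    exponent \<open>r - 1\<close>.\<close>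
  obtain s where r: "r = Suc s" using assms(2) by (cases r) auto
  have "real k * real (h0 k r) - real (h0 k (r + 1)) =
      1 / (real k + 1) * (real k * (\<Sum>j = 1..k. C j * l j ^ s) - (\<Sum>j = 1..k. C j * l j ^ Suc s))"
    unfolding r Suc_eq_plus1[symmetric] h0_Suc_spectral C_def l_def by (simp add: right_diff_distrib)
  \<comment> \<open>Factoring out \<open>l j ^ s\<close> leaves \<open>real k - l j\<close>, the
    last factor of the claim.\<close>
  also have "\<dots> = 1 / (real k + 1) * (\<Sum>j = 1..k. C j * l j ^ s * (real k - l j))"
    unfolding sum_distrib_left sum_subtractf[symmetric] by (simp add: algebra_simps)
  finally have *: "real k * real (h0 k r) - real (h0 k (r + 1)) =
      1 / (real k + 1) * (\<Sum>j = 1..k. C j * l j ^ s * (real k - l j))" .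
  have "real (h0 k r) / real k ^ r - real (h0 k (r + 1)) / real k ^ (r + 1) =
      (real k * real (h0 k r) - real (h0 k (r + 1))) / real k ^ (r + 1)"
    using assms(1) by (simp add: diff_divide_distrib)
  also have "\<dots> = 1 / ((real k + 1) * real k ^ (r + 1)) * (\<Sum>j = 1..k. C j * l j ^ s * (real k - l j))"
    unfolding * by simp
  finally show "real (h0 k r) / real k ^ r - real (h0 k (r + 1)) / real k ^ (r + 1) =
           1 / ((real k + 1) * real k ^ (r + 1)) *
           (\<Sum>j = 1..k. (1 + (-1) ^ (j + 1)) * (cot (real j * pi / (2 * (real k + 1))))\<^sup>2 *
              (1 + 2 * cos (real j * pi / (real k + 1))) ^ (r - 1) *
              (real k - 1 - 2 * cos (real j * pi / (real k + 1))))"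
    by (simp add: C_def l_def r diff_diff_eq)
qed

end
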